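(* Let $(P,\preceq)$ be a locally finite lattice and let $f:P\to\mathbb{C}$ be semimultiplicative with $f(x)\neq0$ for all $x\in P$. Let $X=\{x_1,\dots,x_n\}$, $Y=\{y_1,\dots,y_n\}\subseteq P$ be indexed so that $x_i\preceq x_j\Rightarrow i\le j$ and $y_i\preceq y_j\Rightarrow i\le j$, let $D=\{d_1,\dots,d_m\}$ be any finite subset of $P$ containing all $x_i\vee y_j$, indexed so that $d_i\preceq d_j\Rightarrow i\le j$, and let $X_i=X\setminus\{x_i\}$, $Y_i=Y\setminus\{y_i\}$. If $(X,Y)_f$ is invertible, then its inverse is the $n\times n$ matrix $B=(b_{ij})$ with $$b_{ij}=\frac{(-1)^{i+j}}{f(x_j)f(y_i)\det(X,Y)_f}\Big(\prod_{v=1}^n f(x_v)f(y_v)\Big)\sum_{1\le k_1<\cdots<k_{n-1}\le m}\det E(X_j)_{(k_1,\dots,k_{n-1})}\det E(Y_i)_{(k_1,\dots,k_{n-1})}\,\Psi_{D,1/f}(d_{k_1})\cdots\Psi_{D,1/f}(d_{k_{n-1}}).$$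
   Context: $f$ is semimultiplicative if $f(x)f(y)=f(x\wedge y)f(x\vee y)$ for all $x,y\in P$. $(X,Y)_f$ is the $n\times n$ matrix with $(i,j)$ entry $f(x_i\wedge y_j)$. $\Psi_{D,1/f}$ is defined on $D$ recursively by $\Psi_{D,1/f}(d_k)=1/f(d_k)-\sum_{d_v\in D,\ d_k\prec d_v}\Psi_{D,1/f}(d_v)$. For a subset $Z=\{z_1,\dots,z_r\}$ of $P$ (in its induced order), $E(Z)$ is the $r\times m$ matrix with $(i,j)$ entry $1$ if $z_i\preceq d_j$ and $0$ otherwise; so $E(X_j)$ is $E(X)$ with row $j$ deleted and $E(Y_i)$ is $E(Y)$ with row $i$ deleted. $A_{(k_1,\dots,k_r)}$ denotes the $r\times r$ submatrix of an $r\times m$ matrix $A$ consisting of columns $k_1<\dots<k_r$. *)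

theory Defs
  imports Complex_Main "Jordan_Normal_Form.Determinant" "Jordan_Normal_Form.DL_Submatrix"
begin

text \<open>
  The poset is the whole type. Finite subsets indexed as \<open>z\<^sub>1, \<dots>, z\<^sub>r\<close> are lists, and all
  indices are shifted to start from \<open>0\<close>.
\<close>

definition locally_finite_order :: "'a::order itself \<Rightarrow> bool" where
  "locally_finite_order _ \<longleftrightarrow> (\<forall>a b :: 'a. finite {a..b})"

definition semimultiplicative :: "('a::lattice \<Rightarrow> complex) \<Rightarrow> bool" where
  "semimultiplicative f \<longleftrightarrow> (\<forall>x y. f x * f y = f (inf x y) * f (sup x y))"

text \<open>By antisymmetry, a list indexed in this way has distinct entries.\<close>

definition order_indexed :: "'a::order list \<Rightarrow> bool" where
  "order_indexed zs \<longleftrightarrow>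
     (\<forall>i < length zs. \<forall>j < length zs. zs ! i \<le> zs ! j \<longrightarrow> i \<le> j)"

definition meet_mat :: "'a::lattice list \<Rightarrow> 'a list \<Rightarrow> ('a \<Rightarrow> complex) \<Rightarrow> complex mat" where
  "meet_mat xs ys f = mat (length xs) (length ys) (\<lambda>(i, j). f (inf (xs ! i) (ys ! j)))"

definition E_mat :: "'a::order list \<Rightarrow> 'a list \<Rightarrow> complex mat" where
  "E_mat ds zs = mat (length zs) (length ds) (\<lambda>(i, j). if zs ! i \<le> ds ! j then 1 else 0)"

text \<open>The columns \<open>k\<^sub>1 < \<dots> < k\<^sub>r\<close> are given by the set \<open>K = {k\<^sub>1, \<dots>, k\<^sub>r}\<close>.\<close>

definition col_submat :: "'b mat \<Rightarrow> nat set \<Rightarrow> 'b mat" where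
  "col_submat A K = submatrix A UNIV K"

text \<open>
  The guard makes the recursion well-founded; the value \<open>0\<close> for \<open>d \<notin> D\<close> or infinite \<open>D\<close> is arbitrary.
\<close>

function Psi :: "'a::order set \<Rightarrow> ('a \<Rightarrow> complex) \<Rightarrow> 'a \<Rightarrow> complex" where
  "Psi D g d = (if finite D \<and> d \<in> D then g d - (\<Sum>v \<in> {v \<in> D. d < v}. Psi D g v) else 0)"
  by pat_completeness auto

termination
proof (relation "measure (\<lambda>(D, g, d). card {v \<in> D. d < v})")
  fix D :: "'a set" and g :: "'a \<Rightarrow> complex" and d v :: 'a
  assume D: "finite D \<and> d \<in> D" and v: "v \<in> {v \<in> D. d < v}"
  then have "{w \<in> D. v < w} \<subset> {w \<in> D. d < w}"
    by (auto intro: less_trans)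
  then show "((D, g, v), (D, g, d)) \<in> measure (\<lambda>(D, g, d). card {v \<in> D. d < v})"
    using D by (auto intro: psubset_card_mono)
qed simp

declare Psi.simps [simp del]

lemma Psi_rec:
  assumes "finite D" and "d \<in> D"
  shows "Psi D g d = g d - (\<Sum>v \<in> {v \<in> D. d < v}. Psi D g v)"
  using assms by (subst Psi.simps) simp

end

theory Submission
  imports Defs
begin

text \<open>
  Semimultiplicativity gives \<open>f (inf x y) = f x * f y / f (sup x y)\<close>, so every minor of the meet
  matrix is, up to row and column factors, a minor of the join matrix of \<open>1 / f\<close>. By Moebius
  inversion on \<open>D\<close> the latter factors as \<open>E(X) diag(\<Psi>) E(Y)\<^sup>T\<close>, and the Cauchy--Binet formula
  expands its determinant. The inverse is then read off from the adjugate.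
\<close>

section \<open>The Cauchy--Binet formula\<close>

lemma det_mat:
  "det (mat n n f) = (\<Sum>p | p permutes {0..<n}. signof p * (\<Prod>i=0..<n. f (i, p i)))"
proof -
  have "(\<Prod>i=0..<n. mat n n f $$ (i, p i)) = (\<Prod>i=0..<n. f (i, p i))" if "p permutes {0..<n}" for p
    using that by (intro prod.cong) (auto dest: permutes_in_image)
  then show ?thesis
    by (subst det_def'[of _ n]) (auto intro!: sum.cong)
qed

text \<open>Each Leibniz term meets every row and every column exactly once, so the same product of
  factors comes out of all terms; for the column factors this is a reindexing along the
  permutation.\<close>

lemma det_scale_rows_cols:
  "det (mat n n (\<lambda>(i, j). a i * M i j * b j)) =
     (\<Prod>i=0..<n. a i) * (\<Prod>j=0..<n. b j) * det (mat n n (\<lambda>(i, j). M i j))"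
proof -
  have "(\<Prod>i=0..<n. b (p i)) = (\<Prod>j=0..<n. b j)" if "p permutes {0..<n}" for p
    using prod.permute[OF that, of b] by (simp add: comp_def)
  then show ?thesis
    by (auto simp: det_mat sum_distrib_left prod.distrib intro!: sum.cong)
qed

text \<open>Since \<open>pick K\<close> enumerates \<open>K\<close> increasingly from index 0, its
  inverse counts the elements of \<open>K\<close> below a given one.\<close>

lemma bij_betw_pick:
  assumes "finite K"
  shows "bij_betw (pick K) {0..<card K} K"
proof (rule bij_betwI[where g = "\<lambda>k. card {a \<in> K. a < k}"])
  show "(\<lambda>k. card {a \<in> K. a < k}) \<in> K \<rightarrow> {0..<card K}"
    using assms by (auto intro!: psubset_card_mono)
qed (auto simp: pick_in_set_le card_pick_le pick_card_in_set)

text \<open>Multiplying out the product of sums chooses an inner index \<open>g i\<close> for each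
  row. The factors \<open>a i (g i)\<close> do not involve the permutation, so after exchanging the
  sums the rest is again a Leibniz expansion.\<close>

lemma det_sum_mult:
  fixes a :: "nat \<Rightarrow> nat \<Rightarrow> 'a :: comm_ring_1"
  shows "det (mat r r (\<lambda>(i, j). \<Sum>k<m. a i k * b k j)) =
     (\<Sum>g \<in> {0..<r} \<rightarrow>\<^sub>E {..<m}. (\<Prod>i=0..<r. a i (g i)) * det (mat r r (\<lambda>(i, j). b (g i) j)))"
proof -
  have "det (mat r r (\<lambda>(i, j). \<Sum>k<m. a i k * b k j)) =
      (\<Sum>p | p permutes {0..<r}. \<Sum>g \<in> {0..<r} \<rightarrow>\<^sub>E {..<m}.
         signof p * ((\<Prod>i=0..<r. a i (g i)) * (\<Prod>i=0..<r. b (g i) (p i))))"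
    by (simp add: det_mat prod_sum_PiE sum_distrib_left prod.distrib)
  then show ?thesis
    by (subst (asm) sum.swap) (simp add: det_mat sum_distrib_left ac_simps)
qed

lemma det_rows_permuted:
  assumes "p permutes {0..<r}"
  shows "det (mat r r (\<lambda>(i, j). b (p i) j)) = signof p * det (mat r r (\<lambda>(i, j). b i j))"
proof -
  have "mat r r (\<lambda>(i, j). b (p i) j) = mat r r (\<lambda>(i, j). mat r r (\<lambda>(i, j). b i j) $$ (p i, j))"
    using assms by (intro eq_matI) (auto dest: permutes_in_image)
  then show ?thesis
    using det_permute_rows[OF _ assms, of "mat r r (\<lambda>(i, j). b i j)"] by simp
qed

text \<open>Relative to a fixed bijection \<open>h\<close>, every bijection from \<open>U\<close> to
  \<open>K\<close> is \<open>h\<close> after a unique permutation of \<open>U\<close>. Uniqueness as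
  total functions needs fixed values off \<open>U\<close>: \<open>undefined\<close> for the
  bijections, the identity for the permutations.\<close>

lemma bij_betw_permutes_injections:
  assumes h: "bij_betw h U K"
  shows "bij_betw (\<lambda>p. restrict (h \<circ> p) U) {p. p permutes U} {g \<in> extensional U. bij_betw g U K}"
proof (rule bij_betwI[where g = "\<lambda>g i. if i \<in> U then inv_into U h (g i) else i"])
  show "(\<lambda>p. restrict (h \<circ> p) U) \<in> {p. p permutes U} \<rightarrow> {g \<in> extensional U. bij_betw g U K}"
    using bij_betw_trans[OF permutes_imp_bij h] by auto
  show "(\<lambda>g i. if i \<in> U then inv_into U h (g i) else i)
      \<in> {g \<in> extensional U. bij_betw g U K} \<rightarrow> {p. p permutes U}"
  proof safe
    fix g assume "bij_betw g U K"
    then have "bij_betw (inv_into U h \<circ> g) U U"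
      using bij_betw_inv_into[OF h] by (rule bij_betw_trans)
    then have "bij_betw (\<lambda>i. if i \<in> U then inv_into U h (g i) else i) U U"
      by (rule bij_betw_cong[THEN iffD1, rotated]) simp
    then show "(\<lambda>i. if i \<in> U then inv_into U h (g i) else i) permutes U"
      by (rule bij_imp_permutes) simp
  qed
  show "(\<lambda>i. if i \<in> U then inv_into U h (restrict (h \<circ> p) U i) else i) = p"
    if "p \<in> {p. p permutes U}" for p
    using that h by (auto simp: fun_eq_iff bij_betw_def permutes_in_image permutes_not_in)
  show "restrict (h \<circ> (\<lambda>i. if i \<in> U then inv_into U h (g i) else i)) U = g"
    if "g \<in> {g \<in> extensional U. bij_betw g U K}" for g
    using that h by (auto simp: fun_eq_iff extensional_def bij_betw_def intro!: f_inv_into_f)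
qed

text \<open>In the expansion over \<open>g\<close>, a non-injective \<open>g\<close> repeats a row
  and contributes 0. The injective ones are grouped by their image \<open>K\<close>; there
  \<open>g\<close> is \<open>pick K\<close> after a permutation, whose sign comes from reordering
  the rows of \<open>b\<close>, and the sum over permutations rebuilds the minor of
  \<open>a\<close>.\<close>

lemma Cauchy_Binet:
  fixes a b :: "nat \<Rightarrow> nat \<Rightarrow> 'a :: comm_ring_1"
  shows "det (mat r r (\<lambda>(i, j). \<Sum>k<m. a i k * b k j)) =
     (\<Sum>K | K \<subseteq> {..<m} \<and> card K = r.
        det (mat r r (\<lambda>(i, j). a i (pick K j))) * det (mat r r (\<lambda>(i, j). b (pick K i) j)))"
proof -
  define U where "U = {0..<r}"
  define F where "F g = (\<Prod>i\<in>U. a i (g i)) * det (mat r r (\<lambda>(i, j). b (g i) j))" for g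
  define \<K> where "\<K> = {K. K \<subseteq> {..<m} \<and> card K = r}"
  define I where "I = {g \<in> U \<rightarrow>\<^sub>E {..<m}. inj_on g U}"
  have fin: "finite (U \<rightarrow>\<^sub>E {..<m})" "finite I" "finite \<K>"
    by (auto simp: U_def I_def \<K>_def intro!: finite_PiE)
  have noninj: "F g = 0" if "\<not> inj_on g U" for g
  proof -
    from that obtain i j where "i < r" "j < r" "i \<noteq> j" "g i = g j"
      by (auto simp: inj_on_def U_def)
    then have "det (mat r r (\<lambda>(i, j). b (g i) j)) = 0"
      by (intro det_identical_rows[of _ r i j]) auto
    then show ?thesis by (simp add: F_def)
  qed
  have fibre: "(\<Sum>g | g \<in> I \<and> g ` U = K. F g) =
      det (mat r r (\<lambda>(i, j). a i (pick K j))) * det (mat r r (\<lambda>(i, j). b (pick K i) j))"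
    if "K \<in> \<K>" for K
  proof -
    have K: "K \<subseteq> {..<m}" "card K = r" using that by (auto simp: \<K>_def)
    then have "bij_betw (pick K) U K"
      using bij_betw_pick[of K] by (auto simp: U_def finite_subset)
    then have bij: "bij_betw (\<lambda>p. restrict (pick K \<circ> p) U) {p. p permutes U}
        {g \<in> extensional U. bij_betw g U K}"
      by (rule bij_betw_permutes_injections)
    have "{g. g \<in> I \<and> g ` U = K} = {g \<in> extensional U. bij_betw g U K}"
      using K by (auto simp: I_def bij_betw_def PiE_def)
    then have "(\<Sum>g | g \<in> I \<and> g ` U = K. F g) =
        (\<Sum>p | p permutes U. F (restrict (pick K \<circ> p) U))"
      using sum.reindex_bij_betw[OF bij, of F] by simp
    also have "\<dots> = (\<Sum>p | p permutes U. signof p * (\<Prod>i=0..<r. a i (pick K (p i))) *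
        det (mat r r (\<lambda>(i, j). b (pick K i) j)))"
    proof (intro sum.cong refl)
      fix p assume "p \<in> {p. p permutes U}"
      then have "det (mat r r (\<lambda>(i, j). b (pick K (p i)) j)) =
          signof p * det (mat r r (\<lambda>(i, j). b (pick K i) j))"
        using det_rows_permuted[of p r "\<lambda>i. b (pick K i)"] by (simp add: U_def)
      moreover have "mat r r (\<lambda>(i, j). b (restrict (pick K \<circ> p) U i) j) =
          mat r r (\<lambda>(i, j). b (pick K (p i)) j)"
        by (intro eq_matI) (auto simp: U_def)
      ultimately show "F (restrict (pick K \<circ> p) U) =
          signof p * (\<Prod>i=0..<r. a i (pick K (p i))) * det (mat r r (\<lambda>(i, j). b (pick K i) j))"
        by (simp add: F_def U_def ac_simps)
    qed
    also have "\<dots> =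
        det (mat r r (\<lambda>(i, j). a i (pick K j))) * det (mat r r (\<lambda>(i, j). b (pick K i) j))"
      by (simp add: det_mat[of r "\<lambda>(i, j). a i (pick K j)"] sum_distrib_right U_def)
    finally show ?thesis .
  qed
  have "det (mat r r (\<lambda>(i, j). \<Sum>k<m. a i k * b k j)) = (\<Sum>g \<in> U \<rightarrow>\<^sub>E {..<m}. F g)"
    by (simp add: det_sum_mult F_def U_def)
  also have "\<dots> = (\<Sum>g\<in>I. F g)"
    using fin noninj by (intro sum.mono_neutral_right) (auto simp: I_def)
  also have "\<dots> = (\<Sum>K\<in>\<K>. \<Sum>g | g \<in> I \<and> g ` U = K. F g)"
    using fin by (intro sum.group[symmetric]) (auto simp: I_def \<K>_def U_def card_image)
  also have "\<dots> = (\<Sum>K\<in>\<K>. det (mat r r (\<lambda>(i, j). a i (pick K j))) *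
      det (mat r r (\<lambda>(i, j). b (pick K i) j)))"
    by (intro sum.cong refl fibre)
  finally show ?thesis by (simp add: \<K>_def)
qed

text \<open>\<open>submatrix\<close> silently ignores indices beyond the dimensions; the bound on
  \<open>K\<close> ensures that no column is lost.\<close>

lemma col_submat_eq_mat:
  assumes "A \<in> carrier_mat r m" "K \<subseteq> {..<m}"
  shows "col_submat A K = mat r (card K) (\<lambda>(i, j). A $$ (i, pick K j))"
proof -
  have "{j. j < m \<and> j \<in> K} = K" using assms(2) by auto
  then show ?thesis
    using assms(1) by (auto simp: col_submat_def submatrix_def pick_UNIV)
qed

text \<open>This is Cauchy--Binet for \<open>A\<close> times diag(\<open>w\<close>) times the
  transpose of \<open>B\<close>. The weights go with the second factor, where they scale the rows of
  each minor.\<close>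

lemma det_weighted_Gram:
  fixes A B :: "'a :: comm_ring_1 mat"
  assumes A: "A \<in> carrier_mat r m" and B: "B \<in> carrier_mat r m"
  shows "det (mat r r (\<lambda>(i, j). \<Sum>k<m. A $$ (i, k) * (w k * B $$ (j, k)))) =
     (\<Sum>K | K \<subseteq> {..<m} \<and> card K = r.
        det (col_submat A K) * det (col_submat B K) * (\<Prod>k\<in>K. w k))"
proof -
  have "det (mat r r (\<lambda>(i, j). w (pick K i) * B $$ (j, pick K i))) =
      det (col_submat B K) * (\<Prod>k\<in>K. w k)" if K: "K \<subseteq> {..<m}" "card K = r" for K
  proof -
    have "det (mat r r (\<lambda>(i, j). w (pick K i) * B $$ (j, pick K i))) =
        (\<Prod>i=0..<r. w (pick K i)) * det (mat r r (\<lambda>(i, j). B $$ (j, pick K i)))"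
      using det_scale_rows_cols[of r "\<lambda>i. w (pick K i)" "\<lambda>i j. B $$ (j, pick K i)" "\<lambda>_. 1"]
      by simp
    also have "mat r r (\<lambda>(i, j). B $$ (j, pick K i)) = transpose_mat (col_submat B K)"
      using K by (auto simp: col_submat_eq_mat[OF B])
    also have "det \<dots> = det (col_submat B K)"
      by (rule det_transpose[of _ r]) (use K in \<open>simp add: col_submat_eq_mat[OF B]\<close>)
    also have "(\<Prod>i=0..<r. w (pick K i)) = (\<Prod>k\<in>K. w k)"
      using prod.reindex_bij_betw[OF bij_betw_pick[of K], of w] K by (simp add: finite_subset)
    finally show ?thesis by (simp add: mult.commute)
  qed
  then show ?thesis
    by (subst Cauchy_Binet) (auto intro!: sum.cong simp: col_submat_eq_mat[OF A] ac_simps)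
qed

section \<open>Minors of meet matrices\<close>

text \<open>Moebius inversion from above: the recursion for \<open>Psi\<close> becomes this identity
  once its sum is moved to the other side.\<close>

lemma sum_Psi_above:
  assumes "finite D" "d \<in> D"
  shows "(\<Sum>v | v \<in> D \<and> d \<le> v. Psi D g v) = g d"
proof -
  have "{v \<in> D. d \<le> v} = insert d {v \<in> D. d < v}"
    using assms(2) by (auto simp: le_less)
  then show ?thesis
    using assms by (simp add: Psi_rec[OF assms])
qed

lemma order_indexed_imp_distinct: "order_indexed zs \<Longrightarrow> distinct zs"
  unfolding order_indexed_def distinct_conv_nth by (metis order_refl order_antisym)

lemma prod_list_map_remove1:
  fixes f :: "'a \<Rightarrow> 'b :: comm_monoid_mult"
  shows "x \<in> set xs \<Longrightarrow> f x * prod_list (map f (remove1 x xs)) = prod_list (map f xs)"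
  by (induction xs) (auto simp: mult.left_commute)

lemma prod_list_map_conv_prod_nth:
  fixes f :: "'a \<Rightarrow> 'b :: comm_monoid_mult"
  shows "prod_list (map f xs) = (\<Prod>i<length xs. f (xs ! i))"
  by (induction xs) (simp_all add: prod.lessThan_Suc_shift del: prod.lessThan_Suc)

text \<open>Stated for any two lists of equal length, so that it also applies to the shortened lists
  that index the minors.\<close>

lemma det_meet_mat:
  fixes f :: "'a :: lattice \<Rightarrow> complex"
  assumes f: "semimultiplicative f" "\<And>x. f x \<noteq> 0"
    and len: "length xs = r" "length ys = r" and ds: "distinct ds"
    and sup: "\<And>x y. x \<in> set xs \<Longrightarrow> y \<in> set ys \<Longrightarrow> sup x y \<in> set ds"
  shows "det (meet_mat xs ys f) =
     prod_list (map f xs) * prod_list (map f ys) *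
     (\<Sum>K | K \<subseteq> {..<length ds} \<and> card K = r.
        det (col_submat (E_mat ds xs) K) * det (col_submat (E_mat ds ys) K) *
        (\<Prod>k\<in>K. Psi (set ds) (\<lambda>z. 1 / f z) (ds ! k)))"
proof -
  let ?w = "\<lambda>k. Psi (set ds) (\<lambda>z. 1 / f z) (ds ! k)"
  let ?M = "\<lambda>i j. \<Sum>k<length ds. E_mat ds xs $$ (i, k) * (?w k * E_mat ds ys $$ (j, k))"
  have entry: "?M i j = 1 / f (sup (xs ! i) (ys ! j))" if ij: "i < r" "j < r" for i j
  proof -
    have s: "sup (xs ! i) (ys ! j) \<in> set ds" using ij len by (intro sup) auto
    \<comment> \<open>The product of the two 0/1 entries indicates that \<open>ds ! k\<close> is
      above both points, that is, above their join.\<close>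
    have "?M i j = (\<Sum>k<length ds. if sup (xs ! i) (ys ! j) \<le> ds ! k then ?w k else 0)"
      using ij len by (intro sum.cong) (auto simp: E_mat_def)
    also have "\<dots> = (\<Sum>v\<in>set ds. if sup (xs ! i) (ys ! j) \<le> v then Psi (set ds) (\<lambda>z. 1 / f z) v else 0)"
      \<comment> \<open>Distinctness of \<open>ds\<close> turns the sum over positions into a sum
        over the set \<open>D\<close> on which \<open>Psi\<close> is defined.\<close>
      by (rule sum.reindex_bij_betw[OF bij_betw_nth]) (use ds in auto)
    also have "\<dots> = (\<Sum>v | v \<in> set ds \<and> sup (xs ! i) (ys ! j) \<le> v. Psi (set ds) (\<lambda>z. 1 / f z) v)"
      by (rule sum.inter_filter[symmetric]) simp
    also have "\<dots> = 1 / f (sup (xs ! i) (ys ! j))"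
      using s by (intro sum_Psi_above) auto
    finally show ?thesis .
  qed
  have "meet_mat xs ys f = mat r r (\<lambda>(i, j). f (xs ! i) * ?M i j * f (ys ! j))"
  proof (rule eq_matI)
    fix i j
    assume "i < dim_row (mat r r (\<lambda>(i, j). f (xs ! i) * ?M i j * f (ys ! j)))"
      and "j < dim_col (mat r r (\<lambda>(i, j). f (xs ! i) * ?M i j * f (ys ! j)))"
    then have ij: "i < r" "j < r" by simp_all
    have "f (xs ! i) * f (ys ! j) = f (inf (xs ! i) (ys ! j)) * f (sup (xs ! i) (ys ! j))"
      using f(1) by (simp add: semimultiplicative_def)
    then show "meet_mat xs ys f $$ (i, j) =
        mat r r (\<lambda>(i, j). f (xs ! i) * ?M i j * f (ys ! j)) $$ (i, j)"
      using ij len f(2)[of "sup (xs ! i) (ys ! j)"]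
      by (simp add: meet_mat_def entry[OF ij] nonzero_eq_divide_eq)
  qed (simp_all add: meet_mat_def len)
  moreover have "E_mat ds xs \<in> carrier_mat r (length ds)" "E_mat ds ys \<in> carrier_mat r (length ds)"
    by (simp_all add: E_mat_def len)
  ultimately show ?thesis
    by (simp add: det_scale_rows_cols det_weighted_Gram prod_list_map_conv_prod_nth len atLeast0LessThan)
qed

section \<open>Cofactors of the meet matrix and its inverse\<close>

lemma nth_remove1:
  assumes "distinct zs" "j < length zs" "i < length zs - 1"
  shows "remove1 (zs ! j) zs ! i = zs ! (if i < j then i else Suc i)"
  using assms
proof (induction zs arbitrary: i j)
  case (Cons z zs)
  show ?case
  proof (cases j)
    case (Suc j')
    then have "z \<noteq> zs ! j'" using Cons.prems by auto
    then show ?thesis using Suc Cons by (cases i) auto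
  qed simp
qed simp

text \<open>The minors of a meet matrix are determinants of meet matrices themselves, since
  \<open>mat_delete\<close> skips an index in the same way as \<open>remove1\<close> does on a
  distinct list.\<close>

lemma mat_delete_meet_mat:
  assumes "distinct xs" "distinct ys" "i < length xs" "j < length ys"
  shows "mat_delete (meet_mat xs ys f) i j =
     meet_mat (remove1 (xs ! i) xs) (remove1 (ys ! j) ys) f"
  using assms
  by (intro eq_matI) (auto simp: mat_delete_def meet_mat_def length_remove1 nth_remove1)

lemma invertible_mat_imp_det_nonzero:
  fixes A :: "'a :: comm_ring_1 mat"
  assumes "invertible_mat A"
  shows "det A \<noteq> 0"
proof -
  from assms have sq: "dim_row A = dim_col A" by (simp add: invertible_mat_def)
  \<comment> \<open>The inverse comes without dimensions. Comparing column counts in both equations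
    makes it square of the size of \<open>A\<close>, as multiplicativity of \<open>det\<close>
    requires.\<close>
  from assms obtain B where AB: "A * B = 1\<^sub>m (dim_row A)" and BA: "B * A = 1\<^sub>m (dim_row B)"
    unfolding invertible_mat_def inverts_mat_def by blast
  have col: "dim_col B = dim_row A"
    using arg_cong[OF AB, of dim_col] unfolding index_mult_mat index_one_mat .
  have row: "dim_row B = dim_row A"
    using arg_cong[OF BA, of dim_col] sq unfolding index_mult_mat index_one_mat by (rule trans[OF sym sym])
  have "A \<in> carrier_mat (dim_row A) (dim_row A)" "B \<in> carrier_mat (dim_row A) (dim_row A)"
    using col row sq unfolding carrier_mat_def by simp_all
  from det_mult[OF this] have "det A * det B = 1"
    unfolding AB det_one by (rule sym)
  then show ?thesis by (metis mult_zero_left zero_neq_one)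
qed

theorem theorem6p9:
  fixes f :: "'a::lattice \<Rightarrow> complex"
    and xs ys ds :: "'a list"
    and n m :: nat
  assumes "locally_finite_order TYPE('a)"
    and "semimultiplicative f"
    and "\<And>x. f x \<noteq> 0"
    and "length xs = n" and "length ys = n" and "length ds = m"
    and "order_indexed xs" and "order_indexed ys" and "order_indexed ds"
    and "\<And>i j. i < n \<Longrightarrow> j < n \<Longrightarrow> sup (xs ! i) (ys ! j) \<in> set ds"
    and "invertible_mat (meet_mat xs ys f)"
  shows "let B = mat n n (\<lambda>(i, j).
             (-1) ^ (i + j) / (f (xs ! j) * f (ys ! i) * det (meet_mat xs ys f)) *
             (\<Prod>v<n. f (xs ! v) * f (ys ! v)) *
             (\<Sum>K | K \<subseteq> {..<m} \<and> card K = n - 1.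
                det (col_submat (E_mat ds (remove1 (xs ! j) xs)) K) *
                det (col_submat (E_mat ds (remove1 (ys ! i) ys)) K) *
                (\<Prod>k\<in>K. Psi (set ds) (\<lambda>z. 1 / f z) (ds ! k))))
         in inverts_mat (meet_mat xs ys f) B \<and> inverts_mat B (meet_mat xs ys f)"
proof -
  define M where "M = meet_mat xs ys f"
  \<comment> \<open>The index \<open>j\<close> deletes from \<open>xs\<close> and \<open>i\<close>
    from \<open>ys\<close>, because entry \<open>(i, j)\<close> of the adjugate is the cofactor at
    \<open>(j, i)\<close>.\<close>
  define S where "S i j = (\<Sum>K | K \<subseteq> {..<m} \<and> card K = n - 1.
      det (col_submat (E_mat ds (remove1 (xs ! j) xs)) K) *
      det (col_submat (E_mat ds (remove1 (ys ! i) ys)) K) *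
      (\<Prod>k\<in>K. Psi (set ds) (\<lambda>z. 1 / f z) (ds ! k)))" for i j
  define B where "B = mat n n (\<lambda>(i, j).
      (-1) ^ (i + j) / (f (xs ! j) * f (ys ! i) * det M) * (\<Prod>v<n. f (xs ! v) * f (ys ! v)) * S i j)"
  note f = assms(2,3) and len = assms(4-6)
  have dist: "distinct xs" "distinct ys" "distinct ds"
    using assms(7-9) by (auto intro: order_indexed_imp_distinct)
  have M: "M \<in> carrier_mat n n" by (simp add: M_def meet_mat_def len)
  have det: "det M \<noteq> 0" using assms(11) by (simp add: M_def invertible_mat_imp_det_nonzero)
  have "B = (1 / det M) \<cdot>\<^sub>m adj_mat M"
  proof (rule eq_matI)
    fix i j assume "i < dim_row ((1 / det M) \<cdot>\<^sub>m adj_mat M)" "j < dim_col ((1 / det M) \<cdot>\<^sub>m adj_mat M)"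
    \<comment> \<open>An index below \<open>n\<close> forces \<open>n\<close> to be positive, so
      \<open>n - 1\<close> is a true predecessor.\<close>
    then have ij: "i < n" "j < n" using M by (auto simp: adj_mat_def)
    let ?xs = "remove1 (xs ! j) xs" and ?ys = "remove1 (ys ! i) ys"
    have "det (mat_delete M j i) = prod_list (map f ?xs) * prod_list (map f ?ys) * S i j"
      unfolding M_def S_def mat_delete_meet_mat[OF dist(1,2), of j i, unfolded len, OF ij(2,1)]
      unfolding len(3)[symmetric]
    proof (rule det_meet_mat[OF f _ _ dist(3)])
      fix x y assume "x \<in> set ?xs" "y \<in> set ?ys"
      then have "x \<in> set xs" "y \<in> set ys" using dist by simp_all
      then show "sup x y \<in> set ds" using assms(10) len by (auto simp: in_set_conv_nth)
    qed (use ij len in \<open>simp_all add: length_remove1\<close>)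
    \<comment> \<open>The minor carries the product over the remaining points only; completing it to
      the full product is what puts \<open>f (xs ! j)\<close>, and likewise
      \<open>f (ys ! i)\<close>, into the denominator.\<close>
    moreover have "f (xs ! j) * prod_list (map f ?xs) = (\<Prod>v<n. f (xs ! v))"
      using prod_list_map_remove1[of "xs ! j" xs f] ij len
      by (simp add: prod_list_map_conv_prod_nth)
    moreover have "f (ys ! i) * prod_list (map f ?ys) = (\<Prod>v<n. f (ys ! v))"
      using prod_list_map_remove1[of "ys ! i" ys f] ij len
      by (simp add: prod_list_map_conv_prod_nth)
    ultimately have "f (xs ! j) * f (ys ! i) * det (mat_delete M j i) =
        (\<Prod>v<n. f (xs ! v) * f (ys ! v)) * S i j"
      by (simp add: prod.distrib ac_simps)
    \<comment> \<open>Shifting both indices to start from 0 changes \<open>i + j\<close> by 2, so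
      the cofactor sign agrees with the one-based formula.\<close>
    then show "B $$ (i, j) = ((1 / det M) \<cdot>\<^sub>m adj_mat M) $$ (i, j)"
      using ij M f(2) det by (simp add: B_def adj_mat_def cofactor_def field_simps)
  qed (use M in \<open>auto simp: B_def adj_mat_def\<close>)
  \<comment> \<open>Both products of \<open>M\<close> with its adjugate equal \<open>det M\<close>
    times the identity, which gives the left and the right inverse at once.\<close>
  then have "M * B = 1\<^sub>m n \<and> B * M = 1\<^sub>m n"
    using adj_mat[OF M] M det by (auto simp: mult_smult_distrib mult_smult_assoc_mat[where n=n and nr=n])
  then have "inverts_mat M B \<and> inverts_mat B M"
    using M by (auto simp: inverts_mat_def B_def)
  then show ?thesis
    by (simp add: Let_def B_def M_def S_def)
qed

end
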